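(* Consider a GSWF on three alternatives with $n\ge1$ voters satisfying the IIA condition, where the choice functions between the pairs of alternatives $(A,B)$, $(B,C)$ and $(C,A)$ are $f,g,h:\{0,1\}^n\to\{0,1\}$, respectively. If the distribution of the individual preferences is an even product distribution $D(\alpha,\beta,\gamma)$ (with $\alpha,\beta,\gamma\ge0$, $\alpha+\beta+\gamma=1/2$), then the probability $W(f,g,h)$ of an irrational choice is $$W(f,g,h)=p_1p_2p_3+(1-p_1)(1-p_2)(1-p_3)+\langle\langle f,g\rangle\rangle_{4\alpha-1}+\langle\langle g,h\rangle\rangle_{4\beta-1}+\langle\langle h,f\rangle\rangle_{4\gamma-1},$$ where $p_1,p_2,p_3$ are the expectations of $f,g,h$, respectively, with respect to the uniform measure on $\{0,1\}^n$.
   Context: There are $n$ voters and three alternatives $A,B,C$. Each voter gives a strict linear ordering of the alternatives; a profile is the collection of the $n$ orderings. Voter $i$'s ordering is encoded by $(x_i,y_i,z_i)\in\{0,1\}^3\setminus\{(0,0,0),(1,1,1)\}$, where $x_i=1$ iff voter $i$ prefers $A$ to $B$, $y_i=1$ iff voter $i$ prefers $B$ to $C$, and $z_i=1$ iff voter $i$ prefers $C$ to $A$. A generalized social welfare function (GSWF) assigns to each profile a preference of the society on each of the three pairs of alternatives (not necessarily transitive). It satisfies Independence of Irrelevant Alternatives (IIA) if the society's preference on each pair depends only on the individual preferences on that pair; so it is given by choice functions $f,g,h:\{0,1\}^n\to\{0,1\}$: society prefers $A$ to $B$ iff $f(x)=1$, $B$ to $C$ iff $g(y)=1$, and $C$ to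 $A$ iff $h(z)=1$. The choice of the society is irrational for a profile if $f(x)=g(y)=h(z)=1$ or $f(x)=g(y)=h(z)=0$ (no linear ordering results), and rational otherwise. Even product distribution $D(\alpha,\beta,\gamma)$: the triples $(x_i,y_i,z_i)$ are independent for different $i$, and for each $i$, $\Pr[(1,1,0)]=\Pr[(0,0,1)]=\alpha$, $\Pr[(0,1,1)]=\Pr[(1,0,0)]=\beta$, $\Pr[(1,0,1)]=\Pr[(0,1,0)]=\gamma$. Fourier-Walsh coefficients: for $S\subset\{1,\ldots,n\}$ let $r_S(x)=\prod_{i\in S}(2x_i-1)$ and $\hat f(S)=2^{-n}\sum_{x\in\{0,1\}^n}f(x)r_S(x)$. For $-1\le\delta\le1$, $\langle\langle f,g\rangle\rangle_\delta=\sum_{S\ne\emptyset}\hat f(S)\hat g(S)\delta^{|S|}$. *)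

theory Defs
  imports "HOL-Probability.Probability"
begin

datatype alternative = Alt_A | Alt_B | Alt_C

typedef ordering = "{r :: alternative rel. strict_linear_order r}"
proof -
  let ?r = "{(Alt_A, Alt_B), (Alt_B, Alt_C), (Alt_A, Alt_C)}"
  have "trans ?r" and "irrefl ?r"
    by (auto simp: trans_def irrefl_def)
  moreover have "total ?r"
  proof (rule total_onI)
    fix a b :: alternative
    assume "a \<noteq> b"
    then show "(a, b) \<in> ?r \<or> (b, a) \<in> ?r"
      by (cases a; cases b) auto
  qed
  ultimately show ?thesis
    by (auto simp: strict_linear_order_on_def)
qed

definition prefers :: "ordering \<Rightarrow> alternative \<Rightarrow> alternative \<Rightarrow> bool" where
  "prefers R a b \<longleftrightarrow> (a, b) \<in> Rep_ordering R"

text \<open>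
  The set of voters is a finite type \<open>'v\<close>, so that \<open>n = CARD('v)\<close>. A point of the cube
  \<open>{0,1}^n\<close> is a function of type \<open>'v \<Rightarrow> bool\<close>, with \<^const>\<open>True\<close> for \<open>1\<close>.
\<close>

type_synonym 'v profile = "'v \<Rightarrow> ordering"

definition encode :: "ordering \<Rightarrow> bool \<times> bool \<times> bool" where
  "encode R = (prefers R Alt_A Alt_B, prefers R Alt_B Alt_C, prefers R Alt_C Alt_A)"

text \<open>
  \<open>F p a b\<close> means that the society prefers \<open>a\<close> to \<open>b\<close> under the profile \<open>p\<close>. On each pair of
  distinct alternatives exactly one of the two strict preferences holds; the values \<open>F p a a\<close>
  carry no meaning and are left unconstrained.
\<close>

type_synonym 'v social_function = "'v profile \<Rightarrow> alternative \<Rightarrow> alternative \<Rightarrow> bool"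

definition gswf :: "'v social_function \<Rightarrow> bool" where
  "gswf F \<longleftrightarrow> (\<forall>p a b. a \<noteq> b \<longrightarrow> (F p a b \<longleftrightarrow> \<not> F p b a))"

definition iia :: "'v social_function \<Rightarrow> bool" where
  "iia F \<longleftrightarrow> (\<forall>a b p q. a \<noteq> b \<longrightarrow>
     (\<forall>i. prefers (p i) a b \<longleftrightarrow> prefers (q i) a b) \<longrightarrow> (F p a b \<longleftrightarrow> F q a b))"

definition is_choice_function ::
    "'v social_function \<Rightarrow> alternative \<Rightarrow> alternative \<Rightarrow> (('v \<Rightarrow> bool) \<Rightarrow> bool) \<Rightarrow> bool" where
  "is_choice_function F a b f \<longleftrightarrow> (\<forall>p. F p a b \<longleftrightarrow> f (\<lambda>i. prefers (p i) a b))"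

definition irrational :: "'v social_function \<Rightarrow> 'v profile \<Rightarrow> bool" where
  "irrational F p \<longleftrightarrow>
     (F p Alt_A Alt_B \<and> F p Alt_B Alt_C \<and> F p Alt_C Alt_A) \<or>
     (\<not> F p Alt_A Alt_B \<and> \<not> F p Alt_B Alt_C \<and> \<not> F p Alt_C Alt_A)"

definition even_product_distribution ::
    "real \<Rightarrow> real \<Rightarrow> real \<Rightarrow> ('v::finite) profile pmf \<Rightarrow> bool" where
  "even_product_distribution \<alpha> \<beta> \<gamma> P \<longleftrightarrow>
     prob_space.indep_vars (measure_pmf P) (\<lambda>_. count_space UNIV) (\<lambda>i p. encode (p i)) UNIV \<and>
     (\<forall>i.
       measure_pmf.prob P {p. encode (p i) = (True, True, False)} = \<alpha> \<and>
       measure_pmf.prob P {p. encode (p i) = (False, False, True)} = \<alpha> \<and>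
       measure_pmf.prob P {p. encode (p i) = (False, True, True)} = \<beta> \<and>
       measure_pmf.prob P {p. encode (p i) = (True, False, False)} = \<beta> \<and>
       measure_pmf.prob P {p. encode (p i) = (True, False, True)} = \<gamma> \<and>
       measure_pmf.prob P {p. encode (p i) = (False, True, False)} = \<gamma>)"

definition irrational_prob :: "'v profile pmf \<Rightarrow> 'v social_function \<Rightarrow> real" where
  "irrational_prob P F = measure_pmf.prob P {p. irrational F p}"

definition walsh :: "'v set \<Rightarrow> ('v \<Rightarrow> bool) \<Rightarrow> real" where
  "walsh S x = (\<Prod>i\<in>S. 2 * of_bool (x i) - 1)"

definition fourier_coeff :: "(('v::finite \<Rightarrow> bool) \<Rightarrow> bool) \<Rightarrow> 'v set \<Rightarrow> real" where
  "fourier_coeff f S = (\<Sum>x\<in>UNIV. of_bool (f x) * walsh S x) / 2 ^ CARD('v)"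

definition noise_product ::
    "real \<Rightarrow> (('v::finite \<Rightarrow> bool) \<Rightarrow> bool) \<Rightarrow> (('v \<Rightarrow> bool) \<Rightarrow> bool) \<Rightarrow> real" where
  "noise_product \<delta> f g = (\<Sum>S | S \<noteq> {}. fourier_coeff f S * fourier_coeff g S * \<delta> ^ card S)"

definition uniform_mean :: "(('v::finite \<Rightarrow> bool) \<Rightarrow> bool) \<Rightarrow> real" where
  "uniform_mean f = measure_pmf.expectation (pmf_of_set UNIV) (\<lambda>x. of_bool (f x))"

end

theory Submission
  imports Defs
begin

text \<open>
  For bits \<open>a, b, c\<close>, the indicator of \<open>a = b = c\<close> is \<open>1 - a - b - c + a b + b c + c a\<close>, which has no
  cubic term. Hence only the pairwise joint laws of \<open>x, y, z\<close> enter \<open>W\<close>. Each of them has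
  uniform marginals, and, for instance, the signs of \<open>x\<^sub>i\<close> and \<open>y\<^sub>i\<close> have correlation \<open>4 \<alpha> - 1\<close>.
  By Walsh expansion and independence of the voters, the expectation of \<open>f(x) g(y)\<close> is
  \<open>p\<^sub>1 p\<^sub>2\<close> plus the noise product.
\<close>

text \<open>Summing over all sets of coordinates expands the product of the factors
  \<open>t i + 1\<close>, where the sign \<open>t i\<close> is 1 exactly when \<open>x\<close> and
  \<open>y\<close> agree at \<open>i\<close>. Each agreement contributes 2, and a single
  disagreement makes the product vanish. This is orthogonality in the dual direction, with points
  fixed and sets summed.\<close>

lemma sum_walsh_mult_walsh:
  fixes x y :: "'v::finite \<Rightarrow> bool"
  shows "(\<Sum>S\<in>UNIV. walsh S x * walsh S y) = (if x = y then 2 ^ CARD('v) else 0)"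
proof -
  define t where "t i = (2 * of_bool (x i) - 1) * (2 * of_bool (y i) - 1 :: real)" for i
  \<comment> \<open>The trivial product over the complement gives the sum the shape of an expanded
    product of binomials, as in \<open>prod_add\<close>.\<close>
  have "(\<Sum>S\<in>UNIV. walsh S x * walsh S y) = (\<Sum>S\<in>Pow UNIV. (\<Prod>i\<in>S. t i) * (\<Prod>i\<in>UNIV - S. 1))"
    by (simp add: walsh_def t_def prod.distrib)
  also have "\<dots> = (\<Prod>i\<in>UNIV. t i + 1)"
    by (rule prod_add[symmetric]) simp
  also have "\<dots> = (if x = y then 2 ^ CARD('v) else 0)"
  proof (cases "x = y")
    case True
    then have "t i + 1 = 2" for i
      by (simp add: t_def)
    with True show ?thesis
      by simp
  next
    case False
    then obtain i where "x i \<noteq> y i"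
      by auto
    then have "t i + 1 = 0"
      by (auto simp: t_def)
    with False show ?thesis
      by (auto intro!: prod_zero)
  qed
  finally show ?thesis .
qed

text \<open>Fourier inversion on the cube: after the definition of the coefficients is inserted and
  the sums are swapped, the inner sum over \<open>S\<close> is the kernel of
  \<open>sum_walsh_mult_walsh\<close>, which singles out \<open>y = x\<close> and cancels the
  normalization.\<close>

lemma walsh_expansion:
  fixes f :: "('v::finite \<Rightarrow> bool) \<Rightarrow> bool"
  shows "of_bool (f x) = (\<Sum>S\<in>UNIV. fourier_coeff f S * walsh S x)"
proof -
  have "(\<Sum>S\<in>UNIV. fourier_coeff f S * walsh S x) =
      (\<Sum>S\<in>UNIV. \<Sum>y\<in>UNIV. of_bool (f y) * (walsh S y * walsh S x) / 2 ^ CARD('v))"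
    by (simp add: fourier_coeff_def sum_divide_distrib sum_distrib_right mult.assoc
        del: sum_of_bool_mult_eq)
  also have "\<dots> = (\<Sum>y\<in>UNIV. of_bool (f y) * (\<Sum>S\<in>UNIV. walsh S y * walsh S x) / 2 ^ CARD('v))"
    by (subst sum.swap) (simp only: sum_divide_distrib sum_distrib_left)
  also have "\<dots> = (\<Sum>y\<in>UNIV. if y = x then of_bool (f y) else 0)"
    by (intro sum.cong refl) (simp add: sum_walsh_mult_walsh)
  finally show ?thesis
    by simp
qed

lemma fourier_coeff_empty: "fourier_coeff f {} = uniform_mean f"
  by (simp add: fourier_coeff_def uniform_mean_def walsh_def integral_pmf_of_set card_fun)

lemma abs_walsh: "\<bar>walsh S x\<bar> = 1"
  unfolding walsh_def abs_prod by (rule prod.neutral) auto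

text \<open>Independence across the voters factors the expectation. A voter in both \<open>S\<close>
  and \<open>T\<close> contributes the correlation \<delta>, a voter in exactly one of them a mean,
  which is 0, and any other voter 1. The dependence between \<open>X i\<close> and
  \<open>Y i\<close> enters only through \<delta>.\<close>

lemma expectation_walsh_mult_walsh:
  fixes X Y :: "'v::finite \<Rightarrow> 'a \<Rightarrow> bool" and P :: "'a pmf"
  assumes indep: "prob_space.indep_vars (measure_pmf P) (\<lambda>_. count_space UNIV) (\<lambda>i p. (X i p, Y i p)) UNIV"
    and X: "\<And>i. measure_pmf.expectation P (\<lambda>p. 2 * of_bool (X i p) - 1) = (0 :: real)"
    and Y: "\<And>i. measure_pmf.expectation P (\<lambda>p. 2 * of_bool (Y i p) - 1) = (0 :: real)"
    and XY: "\<And>i. measure_pmf.expectation P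
               (\<lambda>p. (2 * of_bool (X i p) - 1) * (2 * of_bool (Y i p) - 1)) = \<delta>"
  shows "measure_pmf.expectation P (\<lambda>p. walsh S (\<lambda>i. X i p) * walsh T (\<lambda>i. Y i p)) =
    (if S = T then \<delta> ^ card S else 0)"
proof -
  \<comment> \<open>The default value 1 outside \<open>S\<close> or \<open>T\<close> lets both Walsh
    functions run over all voters, so that their product has one factor per voter, a function of the
    pair \<open>(X i p, Y i p)\<close>.\<close>
  define u where "u i = (\<lambda>(a, b). (if i \<in> S then 2 * of_bool a - 1 else 1) *
      (if i \<in> T then 2 * of_bool b - 1 else 1 :: real))" for i :: 'v
  have u: "measure_pmf.expectation P (\<lambda>p. u i (X i p, Y i p)) =
      (if i \<in> S \<inter> T then \<delta> else if i \<in> S \<union> T then 0 else 1)" for i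
    using X[of i] Y[of i] XY[of i] by (auto simp: u_def)
  have "walsh S (\<lambda>i. X i p) * walsh T (\<lambda>i. Y i p) = (\<Prod>i\<in>UNIV. u i (X i p, Y i p))" for p
    by (simp add: walsh_def u_def prod.distrib prod.If_cases)
  moreover have "measure_pmf.expectation P (\<lambda>p. \<Prod>i\<in>UNIV. u i (X i p, Y i p)) =
      (\<Prod>i\<in>UNIV. measure_pmf.expectation P (\<lambda>p. u i (X i p, Y i p)))"
  proof (rule prob_space.indep_vars_lebesgue_integral[OF measure_pmf.prob_space_axioms])
    show "prob_space.indep_vars (measure_pmf P) (\<lambda>_. borel) (\<lambda>i p. u i (X i p, Y i p)) UNIV"
      by (rule prob_space.indep_vars_compose2[OF measure_pmf.prob_space_axioms indep]) simp
    show "integrable (measure_pmf P) (\<lambda>p. u i (X i p, Y i p))" for i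
      by (rule measure_pmf.integrable_const_bound[where B = 1]) (auto simp: u_def)
  qed simp
  moreover have "(\<Prod>i\<in>UNIV. measure_pmf.expectation P (\<lambda>p. u i (X i p, Y i p))) =
      (if S = T then \<delta> ^ card S else 0)"
  proof (cases "S = T")
    case True
    then show ?thesis
      by (simp add: u prod.If_cases)
  next
    case False
    then obtain i where "i \<in> S \<union> T" "i \<notin> S \<inter> T"
      by auto
    then have "measure_pmf.expectation P (\<lambda>p. u i (X i p, Y i p)) = 0"
      unfolding u by auto
    with False show ?thesis
      by (auto intro!: prod_zero)
  qed
  ultimately show ?thesis
    by simp
qed

text \<open>Both indicators are expanded in Walsh functions, and only the diagonal terms
  \<open>S = T\<close> survive the expectation.\<close>

lemma expectation_mult_noise_product:
  fixes X Y :: "'v::finite \<Rightarrow> 'a \<Rightarrow> bool" and P :: "'a pmf"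
  assumes indep: "prob_space.indep_vars (measure_pmf P) (\<lambda>_. count_space UNIV) (\<lambda>i p. (X i p, Y i p)) UNIV"
    and X: "\<And>i. measure_pmf.expectation P (\<lambda>p. 2 * of_bool (X i p) - 1) = (0 :: real)"
    and Y: "\<And>i. measure_pmf.expectation P (\<lambda>p. 2 * of_bool (Y i p) - 1) = (0 :: real)"
    and XY: "\<And>i. measure_pmf.expectation P
               (\<lambda>p. (2 * of_bool (X i p) - 1) * (2 * of_bool (Y i p) - 1)) = \<delta>"
  shows "measure_pmf.expectation P (\<lambda>p. of_bool (f (\<lambda>i. X i p)) * of_bool (g (\<lambda>i. Y i p))) =
      uniform_mean f * uniform_mean g + noise_product \<delta> f g"
    and "measure_pmf.expectation P (\<lambda>p. of_bool (f (\<lambda>i. X i p))) = uniform_mean f"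
proof -
  have int: "integrable (measure_pmf P) (\<lambda>p. c * (walsh S (\<lambda>i. X i p) * walsh T (\<lambda>i. Y i p)))" for S T c
    by (rule measure_pmf.integrable_const_bound[where B = "\<bar>c\<bar>"]) (auto simp: abs_mult abs_walsh)
  note exp = expectation_walsh_mult_walsh[OF assms]
  have "measure_pmf.expectation P (\<lambda>p. of_bool (f (\<lambda>i. X i p)) * of_bool (g (\<lambda>i. Y i p))) =
      measure_pmf.expectation P (\<lambda>p. \<Sum>S\<in>UNIV. \<Sum>T\<in>UNIV.
        (fourier_coeff f S * fourier_coeff g T) * (walsh S (\<lambda>i. X i p) * walsh T (\<lambda>i. Y i p)))"
    by (simp add: walsh_expansion sum_product mult_ac)
  also have "\<dots> = (\<Sum>S\<in>UNIV. \<Sum>T\<in>UNIV.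
      (fourier_coeff f S * fourier_coeff g T) * (if S = T then \<delta> ^ card S else 0))"
    by (simp only: Bochner_Integration.integral_sum Bochner_Integration.integrable_sum int
        integral_mult_right_zero exp)
  also have "\<dots> = (\<Sum>S\<in>UNIV. fourier_coeff f S * fourier_coeff g S * \<delta> ^ card S)"
    by (simp add: if_distrib cong: if_cong)
  \<comment> \<open>The noise product leaves out the empty set, whose term carries \<delta> to the
    power 0 and is therefore the product of the two means.\<close>
  also have "\<dots> = fourier_coeff f {} * fourier_coeff g {} + noise_product \<delta> f g"
    by (simp add: noise_product_def sum.remove[of UNIV "{}"] Compl_eq_Diff_UNIV[symmetric] Compl_eq)
  finally show "measure_pmf.expectation P (\<lambda>p. of_bool (f (\<lambda>i. X i p)) * of_bool (g (\<lambda>i. Y i p))) =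
      uniform_mean f * uniform_mean g + noise_product \<delta> f g"
    by (simp add: fourier_coeff_empty)
  \<comment> \<open>The factor \<open>walsh {}\<close>, which is constantly 1, makes this the case
    \<open>T = {}\<close> of the same expectation formula, so only \<open>S = {}\<close>
    contributes.\<close>
  have "measure_pmf.expectation P (\<lambda>p. of_bool (f (\<lambda>i. X i p))) =
      measure_pmf.expectation P (\<lambda>p. \<Sum>S\<in>UNIV.
        fourier_coeff f S * (walsh S (\<lambda>i. X i p) * walsh {} (\<lambda>i. Y i p)))"
    by (simp add: walsh_expansion walsh_def[of "{}"])
  also have "\<dots> = (\<Sum>S\<in>UNIV. fourier_coeff f S * (if S = {} then \<delta> ^ card S else 0))"
    by (subst Bochner_Integration.integral_sum) (use int in \<open>auto simp: exp\<close>)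
  also have "\<dots> = fourier_coeff f {}"
    by (simp add: if_distrib cong: if_cong)
  finally show "measure_pmf.expectation P (\<lambda>p. of_bool (f (\<lambda>i. X i p))) = uniform_mean f"
    by (simp add: fourier_coeff_empty)
qed

text \<open>The law of one voter's triple lives on eight points. The six prescribed probabilities
  already sum to twice \<open>\<alpha> + \<beta> + \<gamma>\<close>, that is to 1, so the two
  constant triples have mass 0 and the expectation is a sum over the other six.\<close>

lemma even_product_distribution_expectation:
  fixes P :: "('v::finite) profile pmf" and \<phi> :: "bool \<times> bool \<times> bool \<Rightarrow> real"
  assumes sum: "\<alpha> + \<beta> + \<gamma> = 1 / 2" and P: "even_product_distribution \<alpha> \<beta> \<gamma> P"
  shows "measure_pmf.expectation P (\<lambda>p. \<phi> (encode (p i))) =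
      \<alpha> * (\<phi> (True, True, False) + \<phi> (False, False, True)) +
      \<beta> * (\<phi> (False, True, True) + \<phi> (True, False, False)) +
      \<gamma> * (\<phi> (True, False, True) + \<phi> (False, True, False))"
proof -
  define Q where "Q = map_pmf (\<lambda>p. encode (p i)) P"
  have "pmf Q t = measure_pmf.prob P {p. encode (p i) = t}" for t
    by (simp add: Q_def pmf_map vimage_def)
  with P have pmf: "pmf Q (True, True, False) = \<alpha>" "pmf Q (False, False, True) = \<alpha>"
      "pmf Q (False, True, True) = \<beta>" "pmf Q (True, False, False) = \<beta>"
      "pmf Q (True, False, True) = \<gamma>" "pmf Q (False, True, False) = \<gamma>"
    by (simp_all add: even_product_distribution_def)
  have "(\<Sum>t\<in>UNIV. pmf Q t) = 1"
    by (rule sum_pmf_eq_1) auto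
  then have "pmf Q (True, True, True) + pmf Q (False, False, False) = 0"
    using sum pmf by (simp add: UNIV_bool flip: UNIV_Times_UNIV)
  then have "pmf Q (True, True, True) = 0" "pmf Q (False, False, False) = 0"
    by (simp_all add: add_nonneg_eq_0_iff)
  moreover have "measure_pmf.expectation P (\<lambda>p. \<phi> (encode (p i))) = (\<Sum>t\<in>UNIV. \<phi> t * pmf Q t)"
    by (subst integral_measure_pmf_real[symmetric]) (simp_all add: Q_def)
  ultimately show ?thesis
    using pmf by (simp add: UNIV_bool algebra_simps flip: UNIV_Times_UNIV)
qed

theorem theorem3p1:
  fixes F :: "('v::finite) social_function"
    and f g h :: "('v \<Rightarrow> bool) \<Rightarrow> bool"
    and P :: "'v profile pmf"
    and \<alpha> \<beta> \<gamma> p\<^sub>1 p\<^sub>2 p\<^sub>3 :: real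
  assumes "gswf F" and "iia F"
    and "is_choice_function F Alt_A Alt_B f"
    and "is_choice_function F Alt_B Alt_C g"
    and "is_choice_function F Alt_C Alt_A h"
    and "\<alpha> \<ge> 0" and "\<beta> \<ge> 0" and "\<gamma> \<ge> 0" and "\<alpha> + \<beta> + \<gamma> = 1 / 2"
    and "even_product_distribution \<alpha> \<beta> \<gamma> P"
    and "p\<^sub>1 = uniform_mean f" and "p\<^sub>2 = uniform_mean g" and "p\<^sub>3 = uniform_mean h"
  shows "irrational_prob P F =
      p\<^sub>1 * p\<^sub>2 * p\<^sub>3 + (1 - p\<^sub>1) * (1 - p\<^sub>2) * (1 - p\<^sub>3)
      + noise_product (4 * \<alpha> - 1) f g
      + noise_product (4 * \<beta> - 1) g h
      + noise_product (4 * \<gamma> - 1) h f"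
proof -
  define x y z where "x = (\<lambda>(i :: 'v) (p :: 'v profile). fst (encode (p i)))"
    and "y = (\<lambda>(i :: 'v) (p :: 'v profile). fst (snd (encode (p i))))"
    and "z = (\<lambda>(i :: 'v) (p :: 'v profile). snd (snd (encode (p i))))"
  note xyz = x_def y_def z_def
  note E = even_product_distribution_expectation[OF assms(9,10)]
  \<comment> \<open>Any function \<open>k\<close> of the encoded triples preserves independence
    across voters; \<open>k\<close> will be the projection to two of the three coordinates.\<close>
  have indep: "prob_space.indep_vars (measure_pmf P) (\<lambda>_. count_space UNIV) (\<lambda>i p. k (encode (p i))) UNIV"
    for k :: "bool \<times> bool \<times> bool \<Rightarrow> bool \<times> bool"
    using assms(10) unfolding even_product_distribution_def
    by (intro prob_space.indep_vars_compose2[OF measure_pmf.prob_space_axioms,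
          where X = "\<lambda>i p. encode (p i)" and Y = "\<lambda>_. k"
          and M' = "\<lambda>_. count_space UNIV"]) auto
  \<comment> \<open>Opposite orderings have complementary triples and equal probability, so every
    coordinate is balanced.\<close>
  have Ex: "measure_pmf.expectation P (\<lambda>p. 2 * of_bool (x i p) - 1) = (0 :: real)" for i
    using E[of "\<lambda>t. 2 * of_bool (fst t) - 1" i] by (simp add: xyz)
  have Ey: "measure_pmf.expectation P (\<lambda>p. 2 * of_bool (y i p) - 1) = (0 :: real)" for i
    using E[of "\<lambda>t. 2 * of_bool (fst (snd t)) - 1" i] by (simp add: xyz)
  have Ez: "measure_pmf.expectation P (\<lambda>p. 2 * of_bool (z i p) - 1) = (0 :: real)" for i
    using E[of "\<lambda>t. 2 * of_bool (snd (snd t)) - 1" i] by (simp add: xyz)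
  \<comment> \<open>Among the six triples, the first two bits agree only on (1,1,0) and (0,0,1),
    with total probability \<open>2 * \<alpha>\<close>; the correlation is
    \<open>2 * \<alpha> - (1 - 2 * \<alpha>)\<close>. The other two pairs agree with probability
    \<open>2 * \<beta>\<close> and \<open>2 * \<gamma>\<close>.\<close>
  have Exy: "measure_pmf.expectation P (\<lambda>p. (2 * of_bool (x i p) - 1) * (2 * of_bool (y i p) - 1)) = 4 * \<alpha> - 1" for i
    using E[of "\<lambda>t. (2 * of_bool (fst t) - 1) * (2 * of_bool (fst (snd t)) - 1)" i] assms(9)
    by (simp add: xyz)
  have Eyz: "measure_pmf.expectation P (\<lambda>p. (2 * of_bool (y i p) - 1) * (2 * of_bool (z i p) - 1)) = 4 * \<beta> - 1" for i
    using E[of "\<lambda>t. (2 * of_bool (fst (snd t)) - 1) * (2 * of_bool (snd (snd t)) - 1)" i] assms(9)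
    by (simp add: xyz)
  have Ezx: "measure_pmf.expectation P (\<lambda>p. (2 * of_bool (z i p) - 1) * (2 * of_bool (x i p) - 1)) = 4 * \<gamma> - 1" for i
    using E[of "\<lambda>t. (2 * of_bool (snd (snd t)) - 1) * (2 * of_bool (fst t) - 1)" i] assms(9)
    by (simp add: xyz)
  have ixy: "prob_space.indep_vars (measure_pmf P) (\<lambda>_. count_space UNIV) (\<lambda>i p. (x i p, y i p)) UNIV"
    using indep[of "\<lambda>t. (fst t, fst (snd t))"] by (simp add: xyz)
  have iyz: "prob_space.indep_vars (measure_pmf P) (\<lambda>_. count_space UNIV) (\<lambda>i p. (y i p, z i p)) UNIV"
    using indep[of "\<lambda>t. (fst (snd t), snd (snd t))"] by (simp add: xyz)
  have izx: "prob_space.indep_vars (measure_pmf P) (\<lambda>_. count_space UNIV) (\<lambda>i p. (z i p, x i p)) UNIV"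
    using indep[of "\<lambda>t. (snd (snd t), fst t)"] by (simp add: xyz)
  \<comment> \<open>Going around the cycle, each pair supplies one mixed expectation and the mean of
    its first function.\<close>
  note xy = expectation_mult_noise_product[OF ixy Ex Ey Exy, where f = f]
  note yz = expectation_mult_noise_product[OF iyz Ey Ez Eyz, where f = g]
  note zx = expectation_mult_noise_product[OF izx Ez Ex Ezx, where f = h]
  define a b c :: "'v profile \<Rightarrow> real" where "a = (\<lambda>p. of_bool (f (\<lambda>i. x i p)))"
    and "b = (\<lambda>p. of_bool (g (\<lambda>i. y i p)))" and "c = (\<lambda>p. of_bool (h (\<lambda>i. z i p)))"
  have int: "integrable (measure_pmf P) (\<lambda>p. of_bool (k p) :: real)"
    "integrable (measure_pmf P) (\<lambda>p. of_bool (k p) * of_bool (l p) :: real)" for k l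
    by (auto intro!: measure_pmf.integrable_const_bound[where B = 1])
  have ind: "indicator {p. irrational F p} p = 1 - a p - b p - c p + a p * b p + b p * c p + c p * a p" for p
    using assms(3-5)
    by (auto simp: irrational_def is_choice_function_def a_def b_def c_def xyz encode_def indicator_def)
  have "irrational_prob P F = measure_pmf.expectation P (indicator {p. irrational F p})"
    by (simp add: irrational_prob_def)
  also have "\<dots> = measure_pmf.expectation P (\<lambda>p. 1 - a p - b p - c p + a p * b p + b p * c p + c p * a p)"
    by (rule Bochner_Integration.integral_cong) (simp_all only: ind)
  also have "\<dots> = 1 - measure_pmf.expectation P a - measure_pmf.expectation P b -
      measure_pmf.expectation P c + measure_pmf.expectation P (\<lambda>p. a p * b p) +
      measure_pmf.expectation P (\<lambda>p. b p * c p) + measure_pmf.expectation P (\<lambda>p. c p * a p)"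
    unfolding a_def b_def c_def by (simp add: int)
  also have "\<dots> = 1 - p\<^sub>1 - p\<^sub>2 - p\<^sub>3 + (p\<^sub>1 * p\<^sub>2 + noise_product (4 * \<alpha> - 1) f g) +
      (p\<^sub>2 * p\<^sub>3 + noise_product (4 * \<beta> - 1) g h) + (p\<^sub>3 * p\<^sub>1 + noise_product (4 * \<gamma> - 1) h f)"
    by (simp only: a_def b_def c_def xy(1)[where g = g] xy(2) yz(1)[where g = h] yz(2)
        zx(1)[where g = f] zx(2) assms(11-13))
  \<comment> \<open>The cubic terms of \<open>p\<^sub>1 * p\<^sub>2 * p\<^sub>3\<close> and
    \<open>(1 - p\<^sub>1) * (1 - p\<^sub>2) * (1 - p\<^sub>3)\<close> cancel, which leaves the same
    quadratic polynomial as for the bits, now evaluated at the means.\<close>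
  finally show ?thesis
    by (simp add: algebra_simps)
qed

end
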